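(* Let $\mathsf{p}$ be an arbitrary probability distribution on $[-1,1]^n$, and let $v_1,\dots,v_T$ be sampled i.i.d. from $\mathsf{p}$ and revealed one at a time. There is an online algorithm which selects signs $\chi_t\in\{\pm1\}$ such that, with high probability, \[\max_{t\in[T]}\left\|\chi_1v_1+\dots+\chi_tv_t\right\|_\infty=O\big(n^2(\log T+\log n)\big).\]
   Context: An online algorithm must choose $\chi_t$ irrevocably after seeing $v_1,\dots,v_t$ only. "With high probability" means with probability $1-1/\mathrm{poly}(n,T)$, where the exponent can be made as large as desired by increasing the constant in the bound. *)

theory Defs
  imports "HOL-Probability.Probability"
begin

text \<open>Vectors of dimension \<open>n\<close> are functions on \<open>{..<n}\<close> (not elements of a type
  \<open>real ^ 'n\<close>), so that constants can be chosen uniformly in \<open>n\<close>.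
  The measurable space \<open>cube n\<close> is \<open>[-1,1]^n\<close> with its Borel sets; its underlying measure
  plays no role.\<close>

definition cube :: "nat \<Rightarrow> (nat \<Rightarrow> real) measure" where
  "cube n = (\<Pi>\<^sub>M i\<in>{..<n}. restrict_space borel {-1..1})"

definition distribution_on_cube :: "nat \<Rightarrow> (nat \<Rightarrow> real) measure \<Rightarrow> bool" where
  "distribution_on_cube n p \<longleftrightarrow> prob_space p \<and> sets p = sets (cube n)"

definition linf_norm :: "nat \<Rightarrow> (nat \<Rightarrow> real) \<Rightarrow> real" where
  "linf_norm n x = Max ((\<lambda>i. \<bar>x i\<bar>) ` {..<n})"

text \<open>The rule \<open>A t\<close> for the \<open>t\<close>-th sign takes only the vectors indexed by
  \<open>{1..t}\<close> as its input.\<close>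

definition online_algorithm ::
    "nat \<Rightarrow> nat \<Rightarrow> (nat \<Rightarrow> (nat \<Rightarrow> nat \<Rightarrow> real) \<Rightarrow> real) \<Rightarrow> bool" where
  "online_algorithm n T A \<longleftrightarrow>
     (\<forall>t\<in>{1..T}. A t \<in> (\<Pi>\<^sub>M s\<in>{1..t}. cube n) \<rightarrow>\<^sub>M count_space {-1, 1})"

definition chosen_sign ::
    "(nat \<Rightarrow> (nat \<Rightarrow> nat \<Rightarrow> real) \<Rightarrow> real) \<Rightarrow> (nat \<Rightarrow> nat \<Rightarrow> real) \<Rightarrow> nat \<Rightarrow> real" where
  "chosen_sign A v t = A t (restrict v {1..t})"

definition max_discrepancy ::
    "nat \<Rightarrow> nat \<Rightarrow> (nat \<Rightarrow> (nat \<Rightarrow> nat \<Rightarrow> real) \<Rightarrow> real) \<Rightarrow> (nat \<Rightarrow> nat \<Rightarrow> real) \<Rightarrow> real" where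
  "max_discrepancy n T A v =
     Max ((\<lambda>t. linf_norm n (\<lambda>i. \<Sum>s=1..t. chosen_sign A v s * v s i)) ` {1..T})"

end

theory Submission
  imports Defs
begin

text \<open>Let \<open>u 0, \<dots>, u (n - 1)\<close> be an orthonormal eigenbasis of the second moment matrix
  \<open>E[v v\<^sup>T]\<close>, so that the coordinates \<open>X j = \<langle>u j, v\<rangle>\<close> are uncorrelated and bounded by \<open>\<surd>n\<close>. With
  \<open>\<lambda> = 1 / (n \<surd>n)\<close>, choose each sign so as to minimise the potential
  \<open>\<Phi>(d) = \<Sum>j. cosh (\<lambda> \<langle>u j, d\<rangle>)\<close>. Writing \<open>c j\<close> and \<open>s j\<close> for the hyperbolic cosine and sine of
  \<open>\<lambda> \<langle>u j, d\<rangle>\<close>, one step changes \<open>\<Phi>\<close> by at most \<open>\<lambda>\<^sup>2 \<Sum>j. c j (X j)\<^sup>2 - \<lambda> \<bar>\<Sum>j. s j X j\<bar>\<close>.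
  Testing the sum against \<open>\<plusminus> X j / \<surd>n\<close> and averaging over \<open>j\<close> shows
  \<open>E \<bar>\<Sum>j. s j X j\<bar> \<ge> \<lambda> \<Sum>j. \<bar>s j\<bar> E (X j)\<^sup>2\<close>, however different the variances are. Since
  \<open>c j \<le> \<bar>s j\<bar> + 1\<close>, the expected increase of \<open>\<Phi>\<close> is at most \<open>1\<close> per step, and Markov's inequality
  bounds all \<open>\<Phi>\<close> by a polynomial in \<open>n T\<close>. Then every \<open>\<bar>\<langle>u j, d\<rangle>\<bar>\<close> is \<open>O(n \<surd>n log (n T))\<close>, and passing
  from the eigenbasis to the maximum norm costs another factor \<open>\<surd>n\<close>.\<close>

subsection \<open>Orthogonal diagonalisation\<close>

text \<open>Tychonoff's theorem. It is applied to the rows of a matrix and again to the entries of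
  each row.\<close>

lemma compact_pointwise:
  fixes S :: "'i \<Rightarrow> 'a::topological_space set"
  assumes "\<And>i. compact (S i)"
  shows "compact {f. \<forall>i. f i \<in> S i}"
proof -
  have "compactin (product_topology (\<lambda>i. euclidean) UNIV) (Pi\<^sub>E UNIV S)"
    using assms by (simp add: compactin_PiE)
  then show ?thesis
    by (simp add: euclidean_product_topology PiE_def Pi_def extensional_def)
qed

definition bilinear_form :: "nat \<Rightarrow> (nat \<Rightarrow> nat \<Rightarrow> real) \<Rightarrow> (nat \<Rightarrow> real) \<Rightarrow> (nat \<Rightarrow> real) \<Rightarrow> real" where
  "bilinear_form n M y z = (\<Sum>a<n. \<Sum>b<n. y a * M a b * z b)"

lemma bilinear_form_commute:
  assumes "\<And>a b. M a b = M b a"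
  shows "bilinear_form n M y z = bilinear_form n M z y"
  unfolding bilinear_form_def
  by (subst sum.swap) (simp add: assms mult.commute mult.left_commute)

lemma bilinear_form_combination:
  assumes "\<And>a b. M a b = M b a"
  shows "bilinear_form n M (\<lambda>x. c * y x + s * z x) (\<lambda>x. c * y x + s * z x) =
    c\<^sup>2 * bilinear_form n M y y + 2 * c * s * bilinear_form n M y z + s\<^sup>2 * bilinear_form n M z z"
proof -
  have "bilinear_form n M (\<lambda>x. c * y x + s * z x) (\<lambda>x. c * y x + s * z x) =
    c\<^sup>2 * bilinear_form n M y y + c * s * bilinear_form n M y z + c * s * bilinear_form n M z y
      + s\<^sup>2 * bilinear_form n M z z"
    unfolding bilinear_form_def sum_distrib_left sum.distrib[symmetric]
    by (intro sum.cong refl) (simp add: algebra_simps power2_eq_square)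
  then show ?thesis
    using bilinear_form_commute[of M n z y] assms by simp
qed

text \<open>On the unit circle, put \<open>c = cos t\<close> and \<open>s = sin t\<close>. The
  expression vanishes at \<open>t = 0\<close> and is nowhere positive, so \<open>t = 0\<close> is a
  maximum and the derivative \<open>2 * x\<close> is zero there.\<close>

lemma rotation_coefficient_zero:
  fixes x y :: real
  assumes "\<And>c s. c\<^sup>2 + s\<^sup>2 = 1 \<Longrightarrow> 2 * c * s * x + s\<^sup>2 * y \<le> 0"
  shows "x = 0"
proof -
  have "((\<lambda>t. 2 * cos t * sin t * x + (sin t)\<^sup>2 * y) has_real_derivative 2 * x) (at 0)"
    by (auto intro!: derivative_eq_intros)
  then have "2 * x = 0"
    by (rule DERIV_local_max[where d = 1]) (auto intro!: assms)
  then show ?thesis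
    by simp
qed

lemma sum_remove2:
  fixes f :: "nat \<Rightarrow> real"
  assumes "a < n" "b < n" "a \<noteq> b"
  shows "(\<Sum>i<n. f i) = f a + f b + (\<Sum>i\<in>{..<n} - {a, b}. f i)"
proof -
  have "(\<Sum>i<n. f i) = (\<Sum>i\<in>{a, b} \<union> ({..<n} - {a, b}). f i)"
    using assms by (intro sum.cong) auto
  also have "\<dots> = (\<Sum>i\<in>{a, b}. f i) + (\<Sum>i\<in>{..<n} - {a, b}. f i)"
    by (rule sum.union_disjoint) auto
  finally show ?thesis
    using assms by simp
qed

text \<open>Maximise \<open>\<Sum>i. i * Q(u i, u i)\<close> over orthogonal matrices: because the weights are distinct,
  stationarity under the rotation in the plane of \<open>u a\<close> and \<open>u b\<close> forces \<open>Q(u a, u b) = 0\<close>.\<close>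

lemma symmetric_matrix_diagonalisable:
  fixes M :: "nat \<Rightarrow> nat \<Rightarrow> real"
  assumes sym: "\<And>a b. M a b = M b a"
  obtains u :: "nat \<Rightarrow> nat \<Rightarrow> real"
  where "\<And>x y. x < n \<Longrightarrow> y < n \<Longrightarrow> (\<Sum>i<n. u i x * u i y) = (if x = y then 1 else 0)"
    and "\<And>i j. i < n \<Longrightarrow> j < n \<Longrightarrow> i \<noteq> j \<Longrightarrow> bilinear_form n M (u i) (u j) = 0"
proof -
  \<comment> \<open>The columns are required to be orthonormal, which for a square matrix is the
    same as orthonormal rows \<open>u i\<close>. This form yields Parseval's identity
    directly.\<close>
  define orth where "orth u \<longleftrightarrow>
    (\<forall>x<n. \<forall>y<n. (\<Sum>i<n. u i x * u i y) = (if x = y then 1 else 0))" for u :: "nat \<Rightarrow> nat \<Rightarrow> real"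
  \<comment> \<open>Matrices are total functions here, so the entries outside the \<open>n\<close>
    by \<open>n\<close> block are pinned to 0 to give a compact factor at every index.\<close>
  define S :: "nat \<Rightarrow> nat \<Rightarrow> real set"
    where "S i x = (if i < n \<and> x < n then {-1..1} else {0})" for i x
  define B where "B = {u. \<forall>i. u i \<in> {f. \<forall>x. f x \<in> S i x}}"
  define F where "F u = (\<Sum>i<n. real i * bilinear_form n M (u i) (u i))" for u
  have coord: "continuous_on X (\<lambda>u :: nat \<Rightarrow> nat \<Rightarrow> real. u i x)" for X i x
    by (rule continuous_on_product_then_coordinatewise[OF continuous_on_product_then_coordinatewise[OF continuous_on_id]])
  have "compact B"
    unfolding B_def by (intro compact_pointwise) (auto simp: S_def)
  moreover have "closed {u. orth u}"
    unfolding orth_def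
    by (intro closed_Collect_all closed_Collect_imp closed_Collect_eq open_Collect_const
        continuous_on_sum continuous_on_mult coord continuous_on_const)
  ultimately have comp: "compact (B \<inter> {u. orth u})"
    by (rule compact_Int_closed)
  \<comment> \<open>The identity matrix shows that the compact set is nonempty, so the maximum
    exists.\<close>
  have "(\<lambda>i x. if i = x \<and> i < n then 1 else 0) \<in> B \<inter> {u. orth u}"
  proof -
    have "(\<Sum>i<n. (if i = x \<and> i < n then 1 else 0) * (if i = y \<and> i < n then 1 else 0)) =
        (if x = y then 1 else 0 :: real)" if "x < n" for x y
    proof -
      have "(\<Sum>i<n. (if i = x \<and> i < n then 1 else 0) * (if i = y \<and> i < n then 1 else 0)) =
          (\<Sum>i<n. if i = x then (if x = y then 1 else 0 :: real) else 0)"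
        by (intro sum.cong) auto
      then show ?thesis
        using that by simp
    qed
    then show ?thesis
      by (simp add: B_def S_def orth_def)
  qed
  moreover have "continuous_on (B \<inter> {u. orth u}) F"
    unfolding F_def bilinear_form_def
    by (intro continuous_on_sum continuous_on_mult coord continuous_on_const)
  ultimately obtain u where u: "u \<in> B" "orth u"
    and max: "\<And>w. w \<in> B \<Longrightarrow> orth w \<Longrightarrow> F w \<le> F u"
    using continuous_attains_sup[OF comp] by blast
  have diag: "bilinear_form n M (u a) (u b) = 0" if ab: "a < n" "b < n" "a \<noteq> b" for a b
  proof -
    define Q where "Q = bilinear_form n M"
    \<comment> \<open>The left-hand side is exactly the gain in \<open>F\<close> when the rows
      \<open>a\<close> and \<open>b\<close> are rotated by \<open>(c, s)\<close>.\<close>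
    have "2 * c * s * ((real a - real b) * Q (u a) (u b)) +
        s\<^sup>2 * ((real a - real b) * (Q (u b) (u b) - Q (u a) (u a))) \<le> 0"
      if cs: "c\<^sup>2 + s\<^sup>2 = 1" for c s
    proof -
      define w where "w = u(a := \<lambda>x. c * u a x + s * u b x, b := \<lambda>x. (- s) * u a x + c * u b x)"
      have w: "w a = (\<lambda>x. c * u a x + s * u b x)" "w b = (\<lambda>x. (- s) * u a x + c * u b x)"
        "\<And>i. i \<notin> {a, b} \<Longrightarrow> w i = u i"
        using ab by (auto simp: w_def)
      \<comment> \<open>The rotation preserves the joint contribution of the rows \<open>a\<close>
        and \<open>b\<close> to every product of columns.\<close>
      have "w a x * w a y + w b x * w b y = (c\<^sup>2 + s\<^sup>2) * (u a x * u a y + u b x * u b y)" for x y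
        by (simp add: w algebra_simps power2_eq_square)
      then have "(\<Sum>i<n. w i x * w i y) = (\<Sum>i<n. u i x * u i y)" for x y
        using cs by (simp add: sum_remove2[OF ab] w)
      then have ow: "orth w"
        using u by (simp add: orth_def)
      have "w \<in> B"
        unfolding B_def mem_Collect_eq
      proof (intro allI)
        fix i x
        show "w i x \<in> S i x"
        proof (cases "i < n \<and> x < n")
          case True
          \<comment> \<open>A unit column has entries of modulus at most 1, so the rotated matrix
            cannot leave the box.\<close>
          have "(w i x)\<^sup>2 \<le> (\<Sum>i<n. (w i x)\<^sup>2)"
            using True by (intro member_le_sum) auto
          also have "\<dots> = 1"
            using ow True by (simp add: orth_def power2_eq_square)
          finally have "\<bar>w i x\<bar> \<le> 1"
            by (simp add: abs_square_le_1)
          then show ?thesis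
            using True by (auto simp: S_def)
        next
          case False
          have "u j y = 0" if "\<not> (j < n \<and> y < n)" for j y
          proof -
            have "u j y \<in> S j y"
              using u(1) by (simp add: B_def)
            then show ?thesis
              unfolding S_def if_not_P[OF that] by simp
          qed
          then have "w i x = 0"
            using False ab by (auto simp: w_def)
          then show ?thesis
            unfolding S_def if_not_P[OF False] by simp
        qed
      qed
      then have "F w \<le> F u"
        using max ow by blast
      then have "real a * Q (w a) (w a) + real b * Q (w b) (w b) \<le>
          real a * Q (u a) (u a) + real b * Q (u b) (u b)"
        by (simp add: F_def Q_def sum_remove2[OF ab] w(3))
      moreover have "Q (w a) (w a) =
          c\<^sup>2 * Q (u a) (u a) + 2 * c * s * Q (u a) (u b) + s\<^sup>2 * Q (u b) (u b)"
        "Q (w b) (w b) =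
          s\<^sup>2 * Q (u a) (u a) - 2 * c * s * Q (u a) (u b) + c\<^sup>2 * Q (u b) (u b)"
        unfolding Q_def w(1,2) bilinear_form_combination[OF sym] by simp_all
      moreover have "c\<^sup>2 = 1 - s\<^sup>2"
        using cs by simp
      ultimately have "real a * ((1 - s\<^sup>2) * Q (u a) (u a) + 2 * c * s * Q (u a) (u b) + s\<^sup>2 * Q (u b) (u b))
          + real b * (s\<^sup>2 * Q (u a) (u a) - 2 * c * s * Q (u a) (u b) + (1 - s\<^sup>2) * Q (u b) (u b))
          \<le> real a * Q (u a) (u a) + real b * Q (u b) (u b)"
        by metis
      then show ?thesis
        by (simp add: algebra_simps)
    qed
    then have "(real a - real b) * Q (u a) (u b) = 0"
      by (rule rotation_coefficient_zero)
    then show ?thesis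
      using ab by (simp add: Q_def)
  qed
  show thesis
    using that[of u] u(2) diag by (simp add: orth_def)
qed

subsection \<open>Estimates for hyperbolic functions\<close>

text \<open>Since \<open>sinh x - x\<close> is odd and nonnegative for \<open>x >= 0\<close>, the
  left-hand side equals \<open>exp \<bar>z\<bar> - 1 - \<bar>z\<bar>\<close>. It collects the
  second-order errors of one step.\<close>

lemma cosh_sinh_remainder_le:
  fixes z :: real
  assumes "\<bar>z\<bar> \<le> 1"
  shows "(cosh z - 1) + \<bar>sinh z - z\<bar> \<le> z\<^sup>2"
proof -
  have rem: "\<bar>sinh z - z\<bar> = sinh \<bar>z\<bar> - \<bar>z\<bar>"
  proof -
    have *: "x \<le> sinh x" if "0 \<le> x" for x :: real
      using real_le_x_sinh[OF that] by (simp add: sinh_field_def exp_minus)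
    show ?thesis
      using *[of z] *[of "- z"] by (cases "0 \<le> z") (auto simp: abs_if)
  qed
  have "cosh \<bar>z\<bar> + sinh \<bar>z\<bar> = exp \<bar>z\<bar>"
    by (rule cosh_plus_sinh)
  moreover have "exp \<bar>z\<bar> \<le> 1 + \<bar>z\<bar> + \<bar>z\<bar>\<^sup>2"
    using assms by (intro exp_bound) auto
  moreover have "cosh \<bar>z\<bar> = cosh z"
    by simp
  ultimately show ?thesis
    using rem by simp
qed

lemma cosh_le_abs_sinh_plus_1: "cosh x \<le> \<bar>sinh x\<bar> + (1::real)"
proof -
  have "(cosh x)\<^sup>2 = (sinh x)\<^sup>2 + 1"
    using hyperbolic_pythagoras[of x] by simp
  also have "\<dots> \<le> (\<bar>sinh x\<bar> + 1)\<^sup>2"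
    by (simp add: power2_eq_square algebra_simps)
  finally show ?thesis
    by (rule power2_le_imp_le) simp
qed

text \<open>Inverts the potential: a bound on a hyperbolic cosine becomes a logarithmic bound on its
  argument.\<close>

lemma abs_le_ln_cosh: "\<bar>x\<bar> \<le> ln (2 * cosh x)" for x :: real
proof -
  have "exp \<bar>x\<bar> \<le> 2 * cosh \<bar>x\<bar>"
    by (simp add: cosh_field_def)
  then show ?thesis
    by (subst ln_ge_iff) (simp_all add: cosh_real_pos)
qed

subsection \<open>Second moments of a distribution on the cube\<close>

locale cube_distribution = prob_space p for p :: "(nat \<Rightarrow> real) measure" +
  fixes n :: nat
  assumes sets_p: "sets p = sets (cube n)"
begin

lemma space_p: "space p = (\<Pi>\<^sub>E i\<in>{..<n}. {-1..1})"
  using sets_eq_imp_space_eq[OF sets_p] by (simp add: cube_def space_PiM space_restrict_space)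

lemma abs_component_le_1: "w \<in> space p \<Longrightarrow> i < n \<Longrightarrow> \<bar>w i\<bar> \<le> 1"
  by (force simp: space_p PiE_def Pi_def)

lemma component_measurable [measurable]:
  assumes "i < n"
  shows "(\<lambda>w. w i) \<in> borel_measurable p"
proof -
  have "(\<lambda>w. w i) \<in> cube n \<rightarrow>\<^sub>M restrict_space borel {-1..1}"
    unfolding cube_def using assms by (intro measurable_component_singleton) simp
  then have "(\<lambda>w. w i) \<in> borel_measurable (cube n)"
    by (simp add: measurable_restrict_space2_iff)
  then show ?thesis
    by (simp add: measurable_cong_sets[OF sets_p refl])
qed

lemma integrable_component_product [simp]:
  assumes "a < n" "b < n"
  shows "integrable p (\<lambda>w. w a * w b)"
proof (rule integrable_const_bound[where B = 1])
  show "AE w in p. norm (w a * w b) \<le> 1"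
    using assms by (auto intro!: AE_I2 mult_le_one abs_component_le_1 simp: abs_mult)
qed (use assms in measurable)

text \<open>The covariance of two coordinates is the bilinear form of the second moment matrix, so
  diagonalising that matrix makes the coordinates uncorrelated.\<close>

lemma decorrelating_basis:
  obtains u :: "nat \<Rightarrow> nat \<Rightarrow> real"
  where "\<And>x y. x < n \<Longrightarrow> y < n \<Longrightarrow> (\<Sum>i<n. u i x * u i y) = (if x = y then 1 else 0)"
    and "\<And>i j. i < n \<Longrightarrow> j < n \<Longrightarrow> i \<noteq> j \<Longrightarrow>
      (\<integral>w. (\<Sum>a<n. u i a * w a) * (\<Sum>b<n. u j b * w b) \<partial>p) = 0"
proof -
  define M where "M a b = (\<integral>w. w a * w b \<partial>p)" for a b
  have "M a b = M b a" for a b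
    by (simp add: M_def mult.commute)
  then obtain u where u: "\<And>x y. x < n \<Longrightarrow> y < n \<Longrightarrow> (\<Sum>i<n. u i x * u i y) = (if x = y then 1 else 0)"
    "\<And>i j. i < n \<Longrightarrow> j < n \<Longrightarrow> i \<noteq> j \<Longrightarrow> bilinear_form n M (u i) (u j) = 0"
    using symmetric_matrix_diagonalisable[of M n] by metis
  have "(\<integral>w. (\<Sum>a<n. u i a * w a) * (\<Sum>b<n. u j b * w b) \<partial>p) = bilinear_form n M (u i) (u j)" for i j
  proof -
    have "(\<integral>w. (\<Sum>a<n. u i a * w a) * (\<Sum>b<n. u j b * w b) \<partial>p) =
        (\<integral>w. (\<Sum>a<n. \<Sum>b<n. (u i a * u j b) * (w a * w b)) \<partial>p)"
      by (simp add: sum_product mult_ac)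
    also have "\<dots> = (\<Sum>a<n. \<integral>w. (\<Sum>b<n. (u i a * u j b) * (w a * w b)) \<partial>p)"
      by (intro Bochner_Integration.integral_sum Bochner_Integration.integrable_sum
          integrable_mult_right integrable_component_product) simp_all
    also have "\<dots> = (\<Sum>a<n. \<Sum>b<n. \<integral>w. (u i a * u j b) * (w a * w b) \<partial>p)"
      by (intro sum.cong refl Bochner_Integration.integral_sum
          integrable_mult_right integrable_component_product) simp_all
    also have "\<dots> = bilinear_form n M (u i) (u j)"
      unfolding bilinear_form_def M_def by (intro sum.cong refl) simp
    finally show ?thesis .
  qed
  then show thesis
    using that[of u] u by simp
qed

end

subsection \<open>Drift of the greedy potential\<close>

text \<open>The basis is a parameter because the signs depend on \<open>p\<close> only through
  it.\<close>

locale greedy_balancing = cube_distribution p n for p :: "(nat \<Rightarrow> real) measure" and n :: nat +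
  fixes u :: "nat \<Rightarrow> nat \<Rightarrow> real"
  assumes n_pos: "n \<ge> 1"
    and orthonormal: "\<And>x y. x < n \<Longrightarrow> y < n \<Longrightarrow>
      (\<Sum>j<n. u j x * u j y) = (if x = y then 1 else 0)"
    and uncorrelated: "\<And>i j. i < n \<Longrightarrow> j < n \<Longrightarrow> i \<noteq> j \<Longrightarrow>
      (\<integral>w. (\<Sum>a<n. u i a * w a) * (\<Sum>a<n. u j a * w a) \<partial>p) = 0"
begin

definition proj :: "nat \<Rightarrow> (nat \<Rightarrow> real) \<Rightarrow> real" where
  "proj j w = (\<Sum>i<n. u j i * w i)"

text \<open>The reciprocal of \<open>n\<close> times the bound \<open>sqrt n\<close> on a single
  projection, so that a signed sum of all \<open>n\<close> projections, once scaled, is at most 1 in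
  modulus.\<close>

definition rate :: real where
  "rate = 1 / (real n * sqrt (real n))"

definition potential :: "(nat \<Rightarrow> real) \<Rightarrow> real" where
  "potential d = (\<Sum>j<n. cosh (rate * proj j d))"

definition greedy_sign :: "(nat \<Rightarrow> real) \<Rightarrow> (nat \<Rightarrow> real) \<Rightarrow> real" where
  "greedy_sign d w =
     (if potential (\<lambda>i. d i + w i) \<le> potential (\<lambda>i. d i - w i) then 1 else - 1)"

primrec greedy_sum :: "(nat \<Rightarrow> nat \<Rightarrow> real) \<Rightarrow> nat \<Rightarrow> nat \<Rightarrow> real" where
  "greedy_sum v 0 = (\<lambda>i. 0)"
| "greedy_sum v (Suc t) =
     (\<lambda>i. greedy_sum v t i + greedy_sign (greedy_sum v t) (v (Suc t)) * v (Suc t) i)"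

text \<open>The earlier signs are not part of the input, so the run is replayed. Signs are numbered
  from 1, hence the sum before step \<open>t\<close> has \<open>t - 1\<close> terms.\<close>

definition greedy_algorithm :: "nat \<Rightarrow> (nat \<Rightarrow> nat \<Rightarrow> real) \<Rightarrow> real" where
  "greedy_algorithm t v = greedy_sign (greedy_sum v (t - 1)) (v t)"

section \<open>Measurability and the online property\<close>

lemma vector_component_measurable:
  assumes "s \<in> I" "i < n"
  shows "(\<lambda>v. v s i) \<in> borel_measurable (\<Pi>\<^sub>M s\<in>I. p)"
  using measurable_compose[OF measurable_component_singleton[OF assms(1), of "\<lambda>_. p"]
      component_measurable[OF assms(2)]] .

lemma potential_measurable:
  assumes [measurable]: "\<And>i. i < n \<Longrightarrow> (\<lambda>x. d x i) \<in> borel_measurable M"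
  shows "(\<lambda>x. potential (d x)) \<in> borel_measurable M"
proof -
  have "(\<lambda>x. cosh (rate * proj j (d x))) \<in> borel_measurable M" for j
    unfolding proj_def cosh_field_def by (measurable; simp)
  then show ?thesis
    unfolding potential_def by simp
qed

lemma greedy_sign_measurable:
  assumes "\<And>i. i < n \<Longrightarrow> (\<lambda>x. d x i) \<in> borel_measurable M"
    and "\<And>i. i < n \<Longrightarrow> (\<lambda>x. w x i) \<in> borel_measurable M"
  shows "(\<lambda>x. greedy_sign (d x) (w x)) \<in> M \<rightarrow>\<^sub>M count_space {-1, 1}"
proof -
  have [measurable]: "(\<lambda>x. potential (\<lambda>i. d x i + w x i)) \<in> borel_measurable M"
    "(\<lambda>x. potential (\<lambda>i. d x i - w x i)) \<in> borel_measurable M"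
    using assms by (auto intro!: potential_measurable)
  show ?thesis
    unfolding greedy_sign_def by measurable
qed

lemma greedy_sum_measurable:
  assumes "{1..t} \<subseteq> I" "i < n"
  shows "(\<lambda>v. greedy_sum v t i) \<in> borel_measurable (\<Pi>\<^sub>M s\<in>I. p)"
  using assms
proof (induction t arbitrary: i)
  case (Suc t)
  then have [measurable]: "(\<lambda>v. v (Suc t) i) \<in> borel_measurable (\<Pi>\<^sub>M s\<in>I. p)" if "i < n" for i
    using that by (intro vector_component_measurable) auto
  have IH [measurable]: "(\<lambda>v. greedy_sum v t i) \<in> borel_measurable (\<Pi>\<^sub>M s\<in>I. p)" if "i < n" for i
    using Suc.prems that by (intro Suc.IH) auto
  have "(\<lambda>v. greedy_sign (greedy_sum v t) (v (Suc t))) \<in> (\<Pi>\<^sub>M s\<in>I. p) \<rightarrow>\<^sub>M count_space {-1, 1}"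
    by (intro greedy_sign_measurable) measurable
  then have [measurable]: "(\<lambda>v. greedy_sign (greedy_sum v t) (v (Suc t))) \<in> borel_measurable (\<Pi>\<^sub>M s\<in>I. p)"
    by (rule measurable_compose) simp
  show ?case
    using \<open>i < n\<close> by simp
qed simp

lemma online_algorithm_greedy: "online_algorithm n T greedy_algorithm"
  unfolding online_algorithm_def
proof
  fix t assume t: "t \<in> {1..T}"
  have "greedy_algorithm t \<in> (\<Pi>\<^sub>M s\<in>{1..t}. p) \<rightarrow>\<^sub>M count_space {-1, 1}"
    unfolding greedy_algorithm_def using t
    by (intro greedy_sign_measurable greedy_sum_measurable vector_component_measurable) auto
  \<comment> \<open>Measurability involves only the sigma-algebra, which \<open>p\<close> shares
    with the cube.\<close>
  then show "greedy_algorithm t \<in> (\<Pi>\<^sub>M s\<in>{1..t}. cube n) \<rightarrow>\<^sub>M count_space {-1, 1}"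
    using measurable_cong_sets[OF sets_PiM_cong[OF refl sets_p] refl] by blast
qed

text \<open>Allows later vectors to be discarded: when signs are computed from restricted inputs,
  when the last vector is integrated out, and when passing to a marginal.\<close>

lemma greedy_sum_cong:
  "(\<And>s. s \<in> {1..t} \<Longrightarrow> v s = v' s) \<Longrightarrow> greedy_sum v t = greedy_sum v' t"
  by (induction t) auto

lemma signed_sum_eq_greedy_sum:
  "(\<Sum>s=1..t. chosen_sign greedy_algorithm v s * v s i) = greedy_sum v t i"
proof (induction t)
  case (Suc t)
  have "greedy_sum (restrict v {1..Suc t}) t = greedy_sum v t"
    by (rule greedy_sum_cong) auto
  then have "chosen_sign greedy_algorithm v (Suc t) = greedy_sign (greedy_sum v t) (v (Suc t))"
    by (simp add: chosen_sign_def greedy_algorithm_def)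
  then show ?case
    using Suc by simp
qed simp

section \<open>Projections onto the basis\<close>

text \<open>Parseval's identity: summing over \<open>j\<close> first, column orthonormality leaves
  only the diagonal terms.\<close>

lemma sum_proj_squares: "(\<Sum>j<n. (proj j w)\<^sup>2) = (\<Sum>x<n. (w x)\<^sup>2)"
proof -
  have "(\<Sum>j<n. (proj j w)\<^sup>2) = (\<Sum>j<n. \<Sum>x<n. \<Sum>y<n. (u j x * u j y) * (w x * w y))"
    by (simp add: proj_def power2_eq_square sum_product mult_ac)
  also have "\<dots> = (\<Sum>x<n. \<Sum>y<n. \<Sum>j<n. (u j x * u j y) * (w x * w y))"
    by (subst sum.swap, rule sum.cong[OF refl], rule sum.swap)
  also have "\<dots> = (\<Sum>x<n. \<Sum>y<n. (if x = y then 1 else 0) * (w x * w y))"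
    by (intro sum.cong refl) (simp add: sum_distrib_right[symmetric] orthonormal)
  also have "\<dots> = (\<Sum>x<n. \<Sum>y<n. if x = y then (w x)\<^sup>2 else 0)"
    by (intro sum.cong refl) (simp add: power2_eq_square)
  also have "\<dots> = (\<Sum>x<n. (w x)\<^sup>2)"
    by simp
  finally show ?thesis .
qed

lemma abs_proj_le:
  assumes "w \<in> space p" "j < n"
  shows "\<bar>proj j w\<bar> \<le> sqrt (real n)"
proof -
  have "(proj j w)\<^sup>2 \<le> (\<Sum>j<n. (proj j w)\<^sup>2)"
    using assms by (intro member_le_sum) auto
  also have "\<dots> = (\<Sum>x<n. (w x)\<^sup>2)"
    by (rule sum_proj_squares)
  also have "\<dots> \<le> (\<Sum>x<n. 1)"
    using abs_component_le_1[OF assms(1)] by (intro sum_mono) (simp add: abs_square_le_1)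
  finally show ?thesis
    using real_le_rsqrt[of "\<bar>proj j w\<bar>" "real n"] by simp
qed

lemma proj_add_mult: "proj j (\<lambda>i. d i + e * w i) = proj j d + e * proj j w"
  by (simp add: proj_def algebra_simps sum.distrib sum_distrib_left)

lemma rate_pos: "rate > 0"
  using n_pos by (simp add: rate_def)

lemma rate_proj_le_1:
  assumes "w \<in> space p" "j < n"
  shows "\<bar>rate * proj j w\<bar> \<le> 1"
proof -
  have "rate * \<bar>proj j w\<bar> \<le> rate * sqrt (real n)"
    using abs_proj_le[OF assms] rate_pos by (intro mult_left_mono) auto
  also have "\<dots> \<le> 1"
    using n_pos by (simp add: rate_def)
  finally show ?thesis
    using rate_pos by (simp add: abs_mult)
qed

section \<open>One step of the greedy rule\<close>

lemma potential_step:
  assumes "e = 1 \<or> e = -1"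
  shows "potential (\<lambda>i. d i + e * w i) =
    (\<Sum>j<n. cosh (rate * proj j d) * cosh (rate * proj j w)) +
    e * (\<Sum>j<n. sinh (rate * proj j d) * sinh (rate * proj j w))"
  unfolding potential_def proj_add_mult using assms
  by (auto simp: distrib_left right_diff_distrib cosh_add cosh_diff sum.distrib sum_subtractf sum_negf)

text \<open>The two signs give \<open>A + B\<close> and \<open>A - B\<close>, by the addition
  formula for \<open>cosh\<close>; the smaller value is \<open>A - \<bar>B\<bar>\<close>.\<close>

lemma potential_greedy_step_le:
  "potential (\<lambda>i. d i + greedy_sign d w * w i) \<le>
    (\<Sum>j<n. cosh (rate * proj j d) * cosh (rate * proj j w)) -
    \<bar>\<Sum>j<n. sinh (rate * proj j d) * sinh (rate * proj j w)\<bar>"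
proof -
  have "potential (\<lambda>i. d i + greedy_sign d w * w i) \<le> potential (\<lambda>i. d i + e * w i)"
    if "e = 1 \<or> e = -1" for e
    using that by (auto simp: greedy_sign_def)
  from this[of 1] this[of "-1"] show ?thesis
    unfolding potential_step[of 1, OF disjI1[OF refl]] potential_step[of "-1", OF disjI2[OF refl]]
    by linarith
qed

text \<open>\<open>\<bar>Y\<bar> \<ge> Y Z\<close> for any random variable with \<open>\<bar>Z\<bar> \<le> 1\<close>. Taking for \<open>Z\<close> the average of the
  \<open>\<plusminus> proj j w / sqrt n\<close> makes the expectation computable from the second moments alone.\<close>

lemma potential_greedy_step_quadratic:
  assumes w: "w \<in> space p"
  shows "potential (\<lambda>i. d i + greedy_sign d w * w i) \<le> potential d +
    rate\<^sup>2 * ((\<Sum>j<n. cosh (rate * proj j d) * (proj j w * proj j w)) -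
      (\<Sum>j<n. \<Sum>i<n. sgn (sinh (rate * proj j d)) * sinh (rate * proj i d) * (proj i w * proj j w)))"
proof -
  define c where "c j = cosh (rate * proj j d)" for j
  define s where "s j = sinh (rate * proj j d)" for j
  define z where "z j = rate * proj j w" for j
  define Y where "Y = (\<Sum>i<n. s i * proj i w)"
  define Z where "Z = (\<Sum>j<n. sgn (s j) * proj j w)"
  have sc: "\<bar>s j\<bar> \<le> c j" for j
    using sinh_le_cosh_real[of "\<bar>rate * proj j d\<bar>"] by (simp add: s_def c_def)
  have "\<bar>Z\<bar> \<le> (\<Sum>j<n. sqrt (real n))"
    unfolding Z_def
    using abs_proj_le[OF w] by (intro order.trans[OF sum_abs] sum_mono) (auto simp: abs_mult abs_sgn_eq)
  \<comment> \<open>This bound dictates the choice of \<open>rate\<close>: it makes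
    \<open>rate * Z\<close> an admissible test variable against \<open>Y\<close>.\<close>
  then have "rate * \<bar>Z\<bar> \<le> 1"
    using n_pos by (simp add: rate_def field_simps)
  then have "(rate * \<bar>Y\<bar>) * (rate * \<bar>Z\<bar>) \<le> (rate * \<bar>Y\<bar>) * 1"
    using rate_pos by (intro mult_left_mono) auto
  moreover have "rate\<^sup>2 * (Y * Z) \<le> (rate * \<bar>Y\<bar>) * (rate * \<bar>Z\<bar>)"
    using abs_ge_self[of "rate\<^sup>2 * (Y * Z)"] rate_pos by (simp add: abs_mult power2_eq_square mult_ac)
  moreover have "rate * \<bar>Y\<bar> = \<bar>\<Sum>j<n. s j * z j\<bar>"
  proof -
    have "(\<Sum>j<n. s j * z j) = rate * Y"
      by (simp add: Y_def z_def sum_distrib_left mult_ac)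
    then show ?thesis
      using rate_pos by (simp add: abs_mult)
  qed
  ultimately have YZ: "rate\<^sup>2 * (Y * Z) \<le> \<bar>\<Sum>j<n. s j * z j\<bar>"
    by linarith
  \<comment> \<open>Replaces \<open>sinh (z j)\<close> by its linear part; the error is charged to
    \<open>c j\<close>, which dominates \<open>\<bar>s j\<bar>\<close>.\<close>
  have "\<bar>\<Sum>j<n. s j * z j\<bar> \<le> \<bar>\<Sum>j<n. s j * sinh (z j)\<bar> + \<bar>\<Sum>j<n. s j * (sinh (z j) - z j)\<bar>"
    by (simp add: right_diff_distrib sum_subtractf)
  also have "\<bar>\<Sum>j<n. s j * (sinh (z j) - z j)\<bar> \<le> (\<Sum>j<n. c j * \<bar>sinh (z j) - z j\<bar>)"
    by (intro order.trans[OF sum_abs] sum_mono) (auto simp: abs_mult intro!: mult_right_mono sc)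
  finally have lin: "\<bar>\<Sum>j<n. s j * z j\<bar> \<le>
    \<bar>\<Sum>j<n. s j * sinh (z j)\<bar> + (\<Sum>j<n. c j * \<bar>sinh (z j) - z j\<bar>)"
    by simp
  \<comment> \<open>The growth of the cosines and the linearisation error are together quadratic in
    \<open>z j\<close>.\<close>
  have "(\<Sum>j<n. c j * cosh (z j)) + (\<Sum>j<n. c j * \<bar>sinh (z j) - z j\<bar>) - (\<Sum>j<n. c j)
      = (\<Sum>j<n. c j * ((cosh (z j) - 1) + \<bar>sinh (z j) - z j\<bar>))"
    by (simp add: algebra_simps sum.distrib sum_subtractf)
  also have "\<dots> \<le> (\<Sum>j<n. c j * (z j)\<^sup>2)"
    using rate_proj_le_1[OF w]
    by (intro sum_mono mult_left_mono cosh_sinh_remainder_le) (auto simp: z_def c_def)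
  also have "\<dots> = rate\<^sup>2 * (\<Sum>j<n. c j * (proj j w * proj j w))"
    by (simp add: z_def sum_distrib_left power2_eq_square mult_ac)
  finally have quad: "(\<Sum>j<n. c j * cosh (z j)) + (\<Sum>j<n. c j * \<bar>sinh (z j) - z j\<bar>) - (\<Sum>j<n. c j)
    \<le> rate\<^sup>2 * (\<Sum>j<n. c j * (proj j w * proj j w))" .
  have YZ_eq: "(\<Sum>j<n. \<Sum>i<n. sgn (s j) * s i * (proj i w * proj j w)) = Y * Z"
    unfolding Y_def Z_def sum_product by (subst sum.swap) (simp add: mult_ac)
  have "potential d = (\<Sum>j<n. c j)"
    by (simp add: potential_def c_def)
  then show ?thesis
    using potential_greedy_step_le[of d w] YZ lin quad
    unfolding c_def[symmetric] s_def[symmetric] z_def[symmetric] right_diff_distrib YZ_eq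
    by linarith
qed

lemma proj_measurable [measurable]: "proj j \<in> borel_measurable p"
  unfolding proj_def by (measurable; simp)

lemma abs_proj_product_le:
  assumes "w \<in> space p" "i < n" "j < n"
  shows "\<bar>proj i w * proj j w\<bar> \<le> real n"
proof -
  have "\<bar>proj i w\<bar> * \<bar>proj j w\<bar> \<le> sqrt (real n) * sqrt (real n)"
    using assms by (intro mult_mono abs_proj_le) auto
  then show ?thesis
    by (simp add: abs_mult)
qed

lemma integrable_proj_product [simp]:
  assumes "i < n" "j < n"
  shows "integrable p (\<lambda>w. proj i w * proj j w)"
  using assms abs_proj_product_le by (intro integrable_const_bound[where B = "real n"]) auto

lemma expectation_proj_product:
  assumes "i < n" "j < n" "i \<noteq> j"
  shows "(\<integral>w. proj i w * proj j w \<partial>p) = 0"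
  using uncorrelated[OF assms] by (simp add: proj_def)

lemma potential_nonneg: "potential d \<ge> 0"
  by (auto simp: potential_def intro!: sum_nonneg)

text \<open>In expectation only the diagonal moments survive, with coefficients
  \<open>c j - \<bar>s j\<bar>\<close> of at most 1. Each such moment is at most \<open>n\<close>,
  so the increase is at most \<open>rate * rate * n * n = 1 / n\<close>.\<close>

lemma expected_potential_greedy_step:
  "(\<integral>\<^sup>+w. ennreal (potential (\<lambda>i. d i + greedy_sign d w * w i)) \<partial>p) \<le> ennreal (potential d + 1)"
proof -
  define c where "c j = cosh (rate * proj j d)" for j
  define s where "s j = sinh (rate * proj j d)" for j
  define m where "m i j = (\<integral>w. proj i w * proj j w \<partial>p)" for i j
  define g where "g w = potential d + rate\<^sup>2 * ((\<Sum>j<n. c j * (proj j w * proj j w)) -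
      (\<Sum>j<n. \<Sum>i<n. sgn (s j) * s i * (proj i w * proj j w)))" for w
  have step: "potential (\<lambda>i. d i + greedy_sign d w * w i) \<le> g w" if "w \<in> space p" for w
    using potential_greedy_step_quadratic[OF that, of d] by (simp add: g_def c_def s_def)
  \<comment> \<open>Being above a nonnegative potential, \<open>g\<close> is nonnegative, so its
    signed integral can be read as a nonnegative one.\<close>
  have g_nonneg: "0 \<le> g w" if "w \<in> space p" for w
    using step[OF that] potential_nonneg by (rule order.trans[rotated])
  have int: "integrable p (\<lambda>w. (\<Sum>j<n. c j * (proj j w * proj j w)))"
    "integrable p (\<lambda>w. (\<Sum>j<n. \<Sum>i<n. sgn (s j) * s i * (proj i w * proj j w)))"
    by (intro Bochner_Integration.integrable_sum integrable_mult_right integrable_proj_product; simp)+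
  have "m j j \<le> real n" if "j < n" for j
  proof -
    have "m j j \<le> (\<integral>w. real n \<partial>p)"
      unfolding m_def using that abs_proj_product_le[OF _ that that]
      by (intro integral_mono_AE) (auto intro!: AE_I2)
    then show ?thesis
      by (simp add: prob_space)
  qed
  moreover have "m j j \<ge> 0" for j
    unfolding m_def by (intro integral_nonneg_AE) auto
  moreover have "c j - \<bar>s j\<bar> \<le> 1" for j
    using cosh_le_abs_sinh_plus_1[of "rate * proj j d"] by (simp add: c_def s_def)
  ultimately have m_le: "(c j - \<bar>s j\<bar>) * m j j \<le> real n" if "j < n" for j
    using mult_right_mono[of "c j - \<bar>s j\<bar>" 1 "m j j"] that by fastforce
  have "(\<Sum>i<n. sgn (s j) * s i * m i j) = (\<Sum>i<n. if i = j then \<bar>s j\<bar> * m j j else 0)" if "j < n" for j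
    using that expectation_proj_product
    by (intro sum.cong refl) (auto simp: m_def sgn_mult_self_eq abs_sgn mult_ac)
  then have off: "(\<Sum>j<n. \<Sum>i<n. sgn (s j) * s i * m i j) = (\<Sum>j<n. \<bar>s j\<bar> * m j j)"
    by simp
  have "integral\<^sup>L p g = potential d + rate\<^sup>2 * ((\<Sum>j<n. c j * m j j) -
      (\<Sum>j<n. \<Sum>i<n. sgn (s j) * s i * m i j))"
  proof -
    have "(\<integral>w. (\<Sum>j<n. c j * (proj j w * proj j w)) \<partial>p) = (\<Sum>j<n. c j * m j j)"
      unfolding m_def by (subst Bochner_Integration.integral_sum) simp_all
    moreover have "(\<integral>w. (\<Sum>j<n. \<Sum>i<n. sgn (s j) * s i * (proj i w * proj j w)) \<partial>p) =
        (\<Sum>j<n. \<integral>w. (\<Sum>i<n. sgn (s j) * s i * (proj i w * proj j w)) \<partial>p)"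
      by (intro Bochner_Integration.integral_sum Bochner_Integration.integrable_sum
          integrable_mult_right integrable_proj_product) simp_all
    moreover have "(\<integral>w. (\<Sum>i<n. sgn (s j) * s i * (proj i w * proj j w)) \<partial>p) =
        (\<Sum>i<n. sgn (s j) * s i * m i j)" if "j < n" for j
      unfolding m_def using that by (subst Bochner_Integration.integral_sum) simp_all
    ultimately show ?thesis
      unfolding g_def using int by (simp add: prob_space)
  qed
  also have "\<dots> = potential d + rate\<^sup>2 * (\<Sum>j<n. (c j - \<bar>s j\<bar>) * m j j)"
    unfolding off by (simp add: left_diff_distrib sum_subtractf)
  also have "\<dots> \<le> potential d + rate\<^sup>2 * (\<Sum>j<n. real n)"
    by (intro add_left_mono mult_left_mono sum_mono m_le) auto
  also have "\<dots> \<le> potential d + 1"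
    using n_pos by (simp add: rate_def power2_eq_square field_simps)
  finally have le: "integral\<^sup>L p g \<le> potential d + 1" .
  have "(\<integral>\<^sup>+w. ennreal (potential (\<lambda>i. d i + greedy_sign d w * w i)) \<partial>p) \<le>
      (\<integral>\<^sup>+w. ennreal (g w) \<partial>p)"
    using step by (intro nn_integral_mono ennreal_leI)
  also have "\<dots> = ennreal (integral\<^sup>L p g)"
    using g_nonneg int by (intro nn_integral_eq_integral) (auto simp: g_def)
  also have "\<dots> \<le> ennreal (potential d + 1)"
    by (rule ennreal_leI[OF le])
  finally show ?thesis .
qed

section \<open>Expected potential over time\<close>

lemma greedy_potential_measurable [measurable]:
  assumes "{1..t} \<subseteq> I"
  shows "(\<lambda>v. potential (greedy_sum v t)) \<in> borel_measurable (\<Pi>\<^sub>M s\<in>I. p)"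
  using assms by (intro potential_measurable greedy_sum_measurable)

text \<open>Induction by Fubini: the last vector is independent of the sum before it, so it can be
  integrated first at a cost of 1. The start value is \<open>n\<close>, as
  \<open>cosh 0 = 1\<close>.\<close>

lemma expected_potential_le:
  "(\<integral>\<^sup>+v. ennreal (potential (greedy_sum v t)) \<partial>(\<Pi>\<^sub>M s\<in>{1..t}. p)) \<le> ennreal (real n + real t)"
proof (induction t)
  case 0
  have "potential (\<lambda>i. 0) = real n"
    by (simp add: potential_def proj_def)
  then show ?case
    by (simp add: PiM_empty nn_integral_count_space_finite)
next
  case (Suc t)
  interpret product_prob_space "\<lambda>_ :: nat. p" "{1..t}"
    by unfold_locales
  have ins: "{1..Suc t} = insert (Suc t) {1..t}"
    by auto
  have "(\<integral>\<^sup>+v. ennreal (potential (greedy_sum v (Suc t))) \<partial>(\<Pi>\<^sub>M s\<in>{1..Suc t}. p)) =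
    (\<integral>\<^sup>+v. (\<integral>\<^sup>+w. ennreal (potential (greedy_sum (v(Suc t := w)) (Suc t))) \<partial>p) \<partial>(\<Pi>\<^sub>M s\<in>{1..t}. p))"
    unfolding ins
    by (intro product_nn_integral_insert measurable_compose[OF greedy_potential_measurable measurable_ennreal]) auto
  also have "\<dots> \<le> (\<integral>\<^sup>+v. ennreal (potential (greedy_sum v t)) + 1 \<partial>(\<Pi>\<^sub>M s\<in>{1..t}. p))"
  proof (intro nn_integral_mono)
    fix v
    have "greedy_sum (v(Suc t := w)) t = greedy_sum v t" for w
      by (rule greedy_sum_cong) auto
    then have "(\<integral>\<^sup>+w. ennreal (potential (greedy_sum (v(Suc t := w)) (Suc t))) \<partial>p) \<le>
        ennreal (potential (greedy_sum v t) + 1)"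
      using expected_potential_greedy_step[of "greedy_sum v t"] by simp
    then show "(\<integral>\<^sup>+w. ennreal (potential (greedy_sum (v(Suc t := w)) (Suc t))) \<partial>p) \<le>
        ennreal (potential (greedy_sum v t)) + 1"
      by (simp add: potential_nonneg)
  qed
  also have "\<dots> = (\<integral>\<^sup>+v. ennreal (potential (greedy_sum v t)) \<partial>(\<Pi>\<^sub>M s\<in>{1..t}. p)) + 1"
    by (subst nn_integral_add) (simp_all add: P.emeasure_space_1 potential_nonneg del: One_nat_def)
  also have "\<dots> \<le> ennreal (real n + real t) + 1"
    by (intro add_right_mono Suc.IH)
  also have "\<dots> = ennreal (real n + real (Suc t))"
    using ennreal_plus[of "real n + real t" 1] by (simp add: add.assoc add.commute)
  finally show ?case .
qed

text \<open>The sum over \<open>t\<close> dominates every single potential, so one use of Markov's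
  inequality will cover all times at once.\<close>

lemma expected_potential_sum_le:
  "(\<integral>\<^sup>+v. ennreal (\<Sum>t=1..T. potential (greedy_sum v t)) \<partial>(\<Pi>\<^sub>M s\<in>{1..T}. p)) \<le>
    ennreal (real T * (real n + real T))"
proof -
  interpret product_prob_space "\<lambda>_ :: nat. p" "{1..T}"
    by unfold_locales
  have "(\<integral>\<^sup>+v. ennreal (potential (greedy_sum v t)) \<partial>(\<Pi>\<^sub>M s\<in>{1..T}. p)) \<le> ennreal (real n + real T)"
    if t: "t \<in> {1..T}" for t
  proof -
    have sub: "{1..t} \<subseteq> {1..T}"
      using t by auto
    have "greedy_sum (restrict v {1..t}) t = greedy_sum v t" for v
      by (rule greedy_sum_cong) auto
    then have "(\<integral>\<^sup>+v. ennreal (potential (greedy_sum v t)) \<partial>(\<Pi>\<^sub>M s\<in>{1..T}. p)) =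
        (\<integral>\<^sup>+v. ennreal (potential (greedy_sum (restrict v {1..t}) t)) \<partial>(\<Pi>\<^sub>M s\<in>{1..T}. p))"
      by simp
    \<comment> \<open>Under the product of \<open>T\<close> copies, the first \<open>t\<close>
      vectors are distributed as the product of \<open>t\<close> copies.\<close>
    also have "\<dots> = (\<integral>\<^sup>+v. ennreal (potential (greedy_sum v t))
        \<partial>(distr (\<Pi>\<^sub>M s\<in>{1..T}. p) (\<Pi>\<^sub>M s\<in>{1..t}. p) (\<lambda>v. restrict v {1..t})))"
      by (rule nn_integral_distr[symmetric])
        (intro measurable_restrict_subset sub, unfold measurable_distr_eq1,
          intro measurable_compose[OF greedy_potential_measurable measurable_ennreal] order.refl)
    also have "\<dots> = (\<integral>\<^sup>+v. ennreal (potential (greedy_sum v t)) \<partial>(\<Pi>\<^sub>M s\<in>{1..t}. p))"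
      by (subst distr_PiM_restrict_finite) (use sub in auto)
    also have "\<dots> \<le> ennreal (real n + real t)"
      by (rule expected_potential_le)
    also have "\<dots> \<le> ennreal (real n + real T)"
      using t by (intro ennreal_leI) auto
    finally show ?thesis .
  qed
  then have "(\<Sum>t=1..T. \<integral>\<^sup>+v. ennreal (potential (greedy_sum v t)) \<partial>(\<Pi>\<^sub>M s\<in>{1..T}. p)) \<le>
      (\<Sum>t=1..T. ennreal (real n + real T))"
    by (rule sum_mono)
  also have "\<dots> = ennreal (real T * (real n + real T))"
    by (subst sum_ennreal) auto
  finally have "(\<Sum>t=1..T. \<integral>\<^sup>+v. ennreal (potential (greedy_sum v t)) \<partial>(\<Pi>\<^sub>M s\<in>{1..T}. p)) \<le>
      ennreal (real T * (real n + real T))" .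
  moreover have "(\<integral>\<^sup>+v. ennreal (\<Sum>t=1..T. potential (greedy_sum v t)) \<partial>(\<Pi>\<^sub>M s\<in>{1..T}. p)) =
      (\<Sum>t=1..T. \<integral>\<^sup>+v. ennreal (potential (greedy_sum v t)) \<partial>(\<Pi>\<^sub>M s\<in>{1..T}. p))"
    unfolding sum_ennreal[OF potential_nonneg, symmetric]
    by (intro nn_integral_sum measurable_compose[OF greedy_potential_measurable measurable_ennreal]) auto
  ultimately show ?thesis
    by simp
qed

section \<open>From the potential to the discrepancy\<close>

lemma linf_norm_le_of_potential:
  assumes "potential d \<le> a"
  shows "linf_norm n d \<le> (real n)\<^sup>2 * ln (2 * a)"
proof -
  have proj: "\<bar>proj j d\<bar> \<le> (real n * sqrt (real n)) * ln (2 * a)" if "j < n" for j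
  proof -
    have "cosh (rate * proj j d) \<le> potential d"
      unfolding potential_def using that by (intro member_le_sum) auto
    then have "ln (2 * cosh (rate * proj j d)) \<le> ln (2 * a)"
      using assms cosh_real_pos[of "rate * proj j d"] by (intro ln_mono) linarith+
    then have "\<bar>rate * proj j d\<bar> \<le> ln (2 * a)"
      using abs_le_ln_cosh[of "rate * proj j d"] by linarith
    then have "rate * \<bar>proj j d\<bar> \<le> ln (2 * a)"
      using rate_pos by (simp add: abs_mult)
    then show ?thesis
      using n_pos by (simp add: rate_def field_simps)
  qed
  \<comment> \<open>Comparing squares below requires \<open>ln (2 * a) >= 0\<close>, which is read
    off from the bound on one projection.\<close>
  have "\<bar>proj 0 d\<bar> \<le> (real n * sqrt (real n)) * ln (2 * a)"
    using n_pos by (intro proj) simp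
  then have "0 \<le> (real n * sqrt (real n)) * ln (2 * a)"
    by linarith
  moreover have "real n * sqrt (real n) > 0"
    using n_pos by simp
  ultimately have ln_nonneg: "0 \<le> ln (2 * a)"
    using mult_le_cancel_left_pos[of "real n * sqrt (real n)" 0 "ln (2 * a)"]
    unfolding mult_zero_right by blast
  have "\<bar>d i\<bar> \<le> (real n)\<^sup>2 * ln (2 * a)" if "i < n" for i
  proof (rule power2_le_imp_le)
    have "\<bar>d i\<bar>\<^sup>2 \<le> (\<Sum>x<n. (d x)\<^sup>2)"
      unfolding power2_abs using that by (intro member_le_sum) auto
    also have "\<dots> = (\<Sum>j<n. (proj j d)\<^sup>2)"
      by (rule sum_proj_squares[symmetric])
    also have "\<dots> \<le> (\<Sum>j<n. ((real n * sqrt (real n)) * ln (2 * a))\<^sup>2)"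
      using proj by (intro sum_mono abs_le_square_iff[THEN iffD1]) fastforce
    also have "\<dots> = ((real n)\<^sup>2 * ln (2 * a))\<^sup>2"
      by (simp add: power_mult_distrib power2_eq_square)
    finally show "\<bar>d i\<bar>\<^sup>2 \<le> ((real n)\<^sup>2 * ln (2 * a))\<^sup>2" .
  qed (use ln_nonneg in simp)
  then show ?thesis
    using n_pos by (auto simp: linf_norm_def Max_le_iff lessThan_empty_iff)
qed

lemma max_discrepancy_measurable:
  "max_discrepancy n T greedy_algorithm \<in> borel_measurable (\<Pi>\<^sub>M s\<in>{1..T}. p)"
  unfolding max_discrepancy_def linf_norm_def signed_sum_eq_greedy_sum
  by (intro borel_measurable_Max borel_measurable_abs greedy_sum_measurable) auto

lemma max_discrepancy_tail:
  assumes "T \<ge> 1"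
  shows "\<P>(v in (\<Pi>\<^sub>M t\<in>{1..T}. p).
      max_discrepancy n T greedy_algorithm v \<le> (real k + 4) * (real n)\<^sup>2 * (ln (real T) + ln (real n)))
    \<ge> 1 - 1 / (real n * real T) ^ k"
\<comment> \<open>If \<open>n * T = 1\<close>, both logarithms vanish, but the claimed probability
  is only 0. Otherwise \<open>n * T >= 2\<close>.\<close>
proof (cases "n * T = 1")
  case True
  then show ?thesis
    by (simp add: measure_nonneg)
next
  case False
  interpret PT: prob_space "\<Pi>\<^sub>M t\<in>{1..T}. p"
    by (intro prob_space_PiM prob_space_axioms)
  define N where "N = real n * real T"
  have "n * T \<ge> 1"
    using n_pos assms by (simp add: Suc_le_eq)
  then have N: "N \<ge> 2"
    using False unfolding N_def of_nat_mult[symmetric] by linarith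
  \<comment> \<open>Markov threshold: dividing the mean bound \<open>2 * N ^ 2\<close> by
    \<open>a\<close> leaves exactly \<open>1 / N ^ k\<close>.\<close>
  define a where "a = 2 * N ^ (k + 2)"
  have a: "a > 0"
    using N by (simp add: a_def)
  define S where "S v = (\<Sum>t=1..T. potential (greedy_sum v t))" for v
  have S_meas [measurable]: "S \<in> borel_measurable (\<Pi>\<^sub>M t\<in>{1..T}. p)"
    unfolding S_def by (intro borel_measurable_sum greedy_potential_measurable) auto
  have "real T * (real n + real T) \<le> 2 * N\<^sup>2"
  proof -
    have "real n \<le> N" "real T \<le> N"
      using n_pos assms by (auto simp: N_def)
    then have "real T * (real n + real T) \<le> N * (N + N)"
      using N by (intro mult_mono) auto
    then show ?thesis
      by (simp add: power2_eq_square)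
  qed
  then have ES: "(\<integral>\<^sup>+v. ennreal (S v) \<partial>(\<Pi>\<^sub>M t\<in>{1..T}. p)) \<le> ennreal (2 * N\<^sup>2)"
    unfolding S_def by (intro order.trans[OF expected_potential_sum_le] ennreal_leI)
  have S_nonneg: "S v \<ge> 0" for v
    by (auto simp: S_def potential_nonneg intro!: sum_nonneg)
  have int: "integrable (\<Pi>\<^sub>M t\<in>{1..T}. p) S"
    using ES S_nonneg
    by (intro integrableI_nonneg S_meas) (auto simp: less_top[symmetric] top_unique)
  have "ennreal (integral\<^sup>L (\<Pi>\<^sub>M t\<in>{1..T}. p) S) \<le> ennreal (2 * N\<^sup>2)"
    using ES nn_integral_eq_integral[OF int] S_nonneg by simp
  then have "integral\<^sup>L (\<Pi>\<^sub>M t\<in>{1..T}. p) S \<le> 2 * N\<^sup>2"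
    by simp
  then have "\<P>(v in (\<Pi>\<^sub>M t\<in>{1..T}. p). S v \<ge> a) \<le> 2 * N\<^sup>2 / a"
    using a S_nonneg
    by (intro order.trans[OF integral_Markov_inequality_measure[OF int, of "{}"]] divide_right_mono) auto
  also have "\<dots> = 1 / N ^ k"
    using N by (simp add: a_def power_add power2_eq_square)
  finally have "1 - 1 / N ^ k \<le> 1 - \<P>(v in (\<Pi>\<^sub>M t\<in>{1..T}. p). S v \<ge> a)"
    by simp
  also have "\<dots> = \<P>(v in (\<Pi>\<^sub>M t\<in>{1..T}. p). \<not> S v \<ge> a)"
    by (rule PT.prob_neg[symmetric]) measurable
  also have "\<dots> \<le> \<P>(v in (\<Pi>\<^sub>M t\<in>{1..T}. p).
      max_discrepancy n T greedy_algorithm v \<le> (real k + 4) * (real n)\<^sup>2 * (ln (real T) + ln (real n)))"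
  proof (rule PT.finite_measure_mono)
    have "ln (2 * a) \<le> (real k + 4) * ln N"
    proof -
      \<comment> \<open>Here \<open>N >= 2\<close> absorbs the factor 4 into two further powers of
        \<open>N\<close>, whence the constant \<open>k + 4\<close>.\<close>
      have "2 * a \<le> N ^ (2 + (k + 2))"
        unfolding power_add[of N 2] using power_mono[OF N, of 2] N by (simp add: a_def)
      then have "ln (2 * a) \<le> ln (N ^ (2 + (k + 2)))"
        using a by (intro ln_mono) simp_all
      also have "\<dots> = real (2 + (k + 2)) * ln N"
        by (rule ln_realpow)
      finally show ?thesis
        by (simp add: add.commute)
    qed
    moreover have "ln N = ln (real T) + ln (real n)"
      using n_pos assms by (simp add: N_def ln_mult)
    ultimately have bound: "(real n)\<^sup>2 * ln (2 * a) \<le> (real k + 4) * (real n)\<^sup>2 * (ln (real T) + ln (real n))"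
      using mult_left_mono[of "ln (2 * a)" "(real k + 4) * ln N" "(real n)\<^sup>2"] by (simp add: mult_ac)
    show "{v \<in> space (\<Pi>\<^sub>M t\<in>{1..T}. p). \<not> a \<le> S v} \<subseteq> {v \<in> space (\<Pi>\<^sub>M t\<in>{1..T}. p).
      max_discrepancy n T greedy_algorithm v \<le> (real k + 4) * (real n)\<^sup>2 * (ln (real T) + ln (real n))}"
    proof safe
      fix v assume "\<not> a \<le> S v"
      have "linf_norm n (greedy_sum v t) \<le> (real k + 4) * (real n)\<^sup>2 * (ln (real T) + ln (real n))"
        if "t \<in> {1..T}" for t
      proof -
        have "potential (greedy_sum v t) \<le> S v"
          unfolding S_def using that by (intro member_le_sum) (auto simp: potential_nonneg)
        then have "potential (greedy_sum v t) \<le> a"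
          using \<open>\<not> a \<le> S v\<close> by simp
        then show ?thesis
          by (rule order.trans[OF linf_norm_le_of_potential bound])
      qed
      then show "max_discrepancy n T greedy_algorithm v \<le> (real k + 4) * (real n)\<^sup>2 * (ln (real T) + ln (real n))"
        unfolding max_discrepancy_def signed_sum_eq_greedy_sum using assms by (auto simp: Max_le_iff)
    qed
  qed (use max_discrepancy_measurable in measurable)
  finally show ?thesis
    by (simp add: N_def)
qed

end

theorem theorem1p4:
  "\<exists>C :: nat \<Rightarrow> real. \<forall>n\<ge>1. \<forall>T\<ge>1. \<forall>p. distribution_on_cube n p \<longrightarrow>
     (\<exists>A. online_algorithm n T A \<and>
       (\<forall>k. \<P>(v in (\<Pi>\<^sub>M t\<in>{1..T}. p).
              max_discrepancy n T A v \<le> C k * (real n)\<^sup>2 * (ln (real T) + ln (real n)))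
            \<ge> 1 - 1 / (real n * real T) ^ k))"
\<comment> \<open>The exponent \<open>k\<close> enters only the constant and the Markov threshold,
  so a single algorithm serves every \<open>k\<close>.\<close>
proof (intro exI[of _ "\<lambda>k. real k + 4"] allI impI)
  fix n T :: nat and p
  assume n: "n \<ge> 1" and T: "T \<ge> 1" and p: "distribution_on_cube n p"
  interpret cube_distribution p n
    using p by (simp add: distribution_on_cube_def cube_distribution_def cube_distribution_axioms_def)
  show "\<exists>A. online_algorithm n T A \<and>
       (\<forall>k. \<P>(v in (\<Pi>\<^sub>M t\<in>{1..T}. p).
              max_discrepancy n T A v \<le> (real k + 4) * (real n)\<^sup>2 * (ln (real T) + ln (real n)))
            \<ge> 1 - 1 / (real n * real T) ^ k)"
  proof (rule decorrelating_basis, goal_cases)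
    case (1 u)
    interpret greedy_balancing p n u
      using n 1 by unfold_locales auto
    show ?thesis
      using online_algorithm_greedy max_discrepancy_tail[OF T] by blast
  qed
qed

end
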